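(* Let $K\ge 1$ and consider the planar SLAM problem with $K$ landmarks and the linearized system model $(F_n,H_n)$ used by the IEKF-SLAM filter, both described in the context. Define the following vectors of $\mathbb{R}^{3+2K}$ (infinitesimal rotation and translations of the global frame): $$\delta X_0^R=\begin{pmatrix}1\\0_{2,1}\\0_{2,1}\\\vdots\\0_{2,1}\end{pmatrix},\qquad \delta X_0^1=\begin{pmatrix}0\\ e_1\\ e_1\\\vdots\\ e_1\end{pmatrix},\qquad \delta X_0^2=\begin{pmatrix}0\\ e_2\\ e_2\\\vdots\\ e_2\end{pmatrix},\qquad e_1=\begin{pmatrix}1\\0\end{pmatrix},\ e_2=\begin{pmatrix}0\\1\end{pmatrix},$$ where the first entry is scalar and is followed by $K+1$ blocks of size $2$. Let $\delta X_0$ be any linear combination of $\delta X_0^R,\delta X_0^1,\delta X_0^2$. Then, whatever the sequence of true states and estimates $(X_n,\hat X_{n|n},\hat X_{n|n-1})_{n\ge 0}$, the vector $\delta X_0$ is an unobservable shift of the linearized system model of the IEKF-SLAM; that is, the sequence defined by $\delta X_n=F_n\,\delta X_{n-1}$ for $n\ge 1$ and initialized at $\delta X_0$ satisfies $H_n\,\delta X_n=0$ for all $n\ge 0$.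
   Context: Notation: $I_m$ is the $m\times m$ identity matrix, $0_{a,b}$ the $a\times b$ zero matrix, and $R(\theta)=\begin{pmatrix}\cos\theta&-\sin\theta\\ \sin\theta&\cos\theta\end{pmatrix}$, $J=\begin{pmatrix}0&-1\\1&0\end{pmatrix}$. SLAM problem. The state is $X_n=(\theta_n,x_n,p_n^1,\dots,p_n^K)\in\mathbb{R}^{3+2K}$, with heading $\theta_n\in\mathbb{R}$, robot position $x_n\in\mathbb{R}^2$ and landmark positions $p_n^j\in\mathbb{R}^2$. The dynamics are $\theta_n=\theta_{n-1}+\omega_n+w_n^\omega$, $x_n=x_{n-1}+R(\theta_{n-1})(v_n+w_n^v)$, $p_n^j=p_{n-1}^j$ for $1\le j\le K$, with inputs $\omega_n\in\mathbb{R}$, $v_n\in\mathbb{R}^2$ and noises $w_n^\omega,w_n^v$. The observation $Y_n$ stacks the vectors $\tilde h[R(\theta_n)^T(p_n^k-x_n)]+V_n^k$, $k=1,\dots,K$, where $\tilde h:\mathbb{R}^2\to\mathbb{R}^q$ ($q\in\{1,2\}$) is a given function, differentiable at the points where its Jacobian is evaluated below, and $V_n^k$ are noises. Linearized model of the IEKF-SLAM. The filter produces estimates $\hat X_{n|n-1}=(\hat\theta_{n|n-1},\hat x_{n|n-1},\hat p^1_{n|n-1},\dots,\hat p^K_{n|n-1})$ (predicted) and $\hat X_{n|n}$ (updated); at $n=0$, $\hat X_{0|-1}$ denotes the point at which the observation is linearized at time $0$. The filter uses, for a true state $X=(\theta,x,p^1,\dots,p^K)$ and an estimate $\hat X=(\hat\theta,\hat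 x,\hat p^1,\dots,\hat p^K)$, the error $$\xi=\begin{pmatrix}\theta-\hat\theta\\ x-\hat x-(\theta-\hat\theta)J\hat x\\ p^1-\hat p^1-(\theta-\hat\theta)J\hat p^1\\ \vdots\\ p^K-\hat p^K-(\theta-\hat\theta)J\hat p^K\end{pmatrix}.$$ The first-order model for this error is $\xi_{n|n-1}=F_n\xi_{n-1|n-1}+G_nw_n$ and $Y_n-h(\hat X_{n|n-1})=H_n\xi_{n|n-1}+V_n$, where $h$ is the noise-free observation map, $F_n=I_{3+2K}$, and $H_n$ is the matrix whose $k$-th block row ($1\le k\le K$) is $$\nabla\tilde h^k\cdot R(\hat\theta_{n|n-1})^T\begin{pmatrix}0_{2,1}&-I_2&0_{2,2(k-1)}&I_2&0_{2,2(K-k)}\end{pmatrix},$$ with $\nabla\tilde h^k$ the Jacobian of $\tilde h$ at $R(\hat\theta_{n|n-1})^T(\hat p^k_{n|n-1}-\hat x_{n|n-1})$. (The noise matrix $G_n$ plays no role in the statement.) Unobservable shift. For a linearized model given by matrices $(F_n)_{n\ge 1}$, $(H_n)_{n\ge 0}$, a vector $\delta X_0$ is an unobservable shift if $H_n\delta X_n=0$ for all $n\ge 0$, where $\delta X_n=F_n\delta X_{n-1}$ for $n\ge1$. *)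

theory Defs
  imports "HOL-Analysis.Analysis"
begin

text \<open>
  With \<open>K = CARD('k)\<close> landmarks, indexed by the nonempty finite type \<open>'k\<close>, the \<open>3 + 2K\<close> scalar
  coordinates of a state (or of an error vector) are the heading, two coordinates for the
  robot position, and two for each landmark.
\<close>

datatype 'k coord = Heading | Robot "2" | Landmark 'k "2"

lemma UNIV_coord:
  "(UNIV :: 'k coord set) = {Heading} \<union> (range Robot \<union> range (case_prod Landmark))"
proof -
  have "c \<in> {Heading} \<union> (range Robot \<union> range (case_prod Landmark))" for c :: "'k coord"
    by (cases c) (auto simp: image_iff)
  then show ?thesis by blast
qed

instance coord :: (finite) finite
  by standard (simp add: UNIV_coord)

lemma CARD_coord: "CARD('k::finite coord) = 3 + 2 * CARD('k)"
proof -
  have 1: "card (range (Robot :: 2 \<Rightarrow> 'k coord)) = 2"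
    by (simp add: card_image inj_def)
  have 2: "card (range (case_prod Landmark :: 'k \<times> 2 \<Rightarrow> 'k coord)) = 2 * CARD('k)"
    by (simp add: card_image inj_def)
  have "CARD('k coord) = 1 + (2 + 2 * CARD('k))"
    unfolding UNIV_coord
    by (subst card_Un_disjoint card_Un_disjoint[of "range Robot"]; (auto simp: 1 2)?)+
  then show ?thesis by simp
qed

type_synonym 'k state = "real ^ 'k coord"

definition heading :: "'k::finite state \<Rightarrow> real" where
  "heading X = X $ Heading"

definition robot :: "'k::finite state \<Rightarrow> real ^ 2" where
  "robot X = (\<chi> i. X $ Robot i)"

definition landmark :: "'k::finite state \<Rightarrow> 'k \<Rightarrow> real ^ 2" where
  "landmark X k = (\<chi> i. X $ Landmark k i)"

definition rot :: "real \<Rightarrow> real ^ 2 ^ 2" where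
  "rot t = vector [vector [cos t, - sin t], vector [sin t, cos t]]"

definition rel_pos :: "'k::finite state \<Rightarrow> 'k \<Rightarrow> real ^ 2" where
  "rel_pos X k = transpose (rot (heading X)) *v (landmark X k - robot X)"

text \<open>
  \<open>predicted r n\<close> and \<open>updated r n\<close> are the estimates of the state at time \<open>n\<close> given the
  observations up to time \<open>n - 1\<close> and \<open>n\<close> respectively; \<open>predicted r 0\<close> is the point at which
  the observation is linearized at time 0. The three sequences are arbitrary: neither the
  dynamics nor the filter equations are imposed on them.
\<close>

record ('k::finite) run =
  true_state :: "nat \<Rightarrow> 'k state"
  updated :: "nat \<Rightarrow> 'k state"
  predicted :: "nat \<Rightarrow> 'k state"

text \<open>
  The linearized model of the invariant filter is expressed in the error coordinates
  \<open>(\<theta> - \<theta>', x - x' - (\<theta> - \<theta>') J x', p - p' - (\<theta> - \<theta>') J p', \<dots>)\<close>, primes denoting estimates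
  and \<open>J\<close> the rotation by a right angle. In these coordinates the propagation matrix
  is the identity and the heading column of the observation matrix vanishes.
\<close>

definition iekf_F :: "'k::finite run \<Rightarrow> nat \<Rightarrow> real ^ 'k coord ^ 'k coord" where
  "iekf_F r n = mat 1"

definition obs_selector :: "'k::finite \<Rightarrow> real ^ 'k coord ^ 2" where
  "obs_selector k = (\<chi> i c. case c of
      Heading \<Rightarrow> 0
    | Robot j \<Rightarrow> (- mat 1 :: real ^ 2 ^ 2) $ i $ j
    | Landmark l j \<Rightarrow> (if l = k then mat 1 else 0 :: real ^ 2 ^ 2) $ i $ j)"

definition iekf_H_block ::
  "(real ^ 2 \<Rightarrow> real ^ 'q) \<Rightarrow> 'k::finite run \<Rightarrow> nat \<Rightarrow> 'k \<Rightarrow> real ^ 'k coord ^ 'q" where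
  "iekf_H_block h r n k =
     jacobian h (at (rel_pos (predicted r n) k))
       ** transpose (rot (heading (predicted r n))) ** obs_selector k"

definition iekf_H ::
  "(real ^ 2 \<Rightarrow> real ^ 'q) \<Rightarrow> 'k::finite run \<Rightarrow> nat \<Rightarrow> real ^ 'k coord ^ ('k \<times> 'q)" where
  "iekf_H h r n = (\<chi> a. iekf_H_block h r n (fst a) $ snd a)"

text \<open>Propagation matrices are indexed from 1; \<open>F 0\<close> is never used.\<close>

primrec shift_seq :: "(nat \<Rightarrow> real ^ 'n ^ 'n) \<Rightarrow> real ^ 'n \<Rightarrow> nat \<Rightarrow> real ^ 'n" where
  "shift_seq F d 0 = d"
| "shift_seq F d (Suc n) = F (Suc n) *v shift_seq F d n"

definition unobservable_shift ::
  "(nat \<Rightarrow> real ^ 'n ^ 'n) \<Rightarrow> (nat \<Rightarrow> real ^ 'n ^ 'm) \<Rightarrow> real ^ 'n \<Rightarrow> bool" where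
  "unobservable_shift F H d \<longleftrightarrow> (\<forall>n. H n *v shift_seq F d n = 0)"

definition rotation_shift :: "'k::finite state" where
  "rotation_shift = (\<chi> c. case c of Heading \<Rightarrow> 1 | Robot i \<Rightarrow> 0 | Landmark k i \<Rightarrow> 0)"

definition translation_shift :: "real ^ 2 \<Rightarrow> 'k::finite state" where
  "translation_shift e = (\<chi> c. case c of Heading \<Rightarrow> 0 | Robot i \<Rightarrow> e $ i | Landmark k i \<Rightarrow> e $ i)"

text \<open>
  Check that \<open>iekf_F\<close> and \<open>iekf_H\<close> are the first-order model of the SLAM system for the
  error \<open>iekf_error\<close>: \<open>D \<mapsto> iekf_error (Y + D) Y\<close> is linear, so the derivatives at the
  estimate \<open>Y\<close> of the propagated error and of the noise-free observation are obtained by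
  applying the two matrices to it.
\<close>

definition quarter_turn :: "real ^ 2 ^ 2" where
  "quarter_turn = vector [vector [0, - 1], vector [1, 0]]"

definition slam_step ::
  "'k::finite state \<Rightarrow> real \<Rightarrow> real ^ 2 \<Rightarrow> real \<Rightarrow> real ^ 2 \<Rightarrow> 'k state" where
  "slam_step X om v w_om w_v = (\<chi> c. case c of
      Heading \<Rightarrow> heading X + om + w_om
    | Robot i \<Rightarrow> (robot X + rot (heading X) *v (v + w_v)) $ i
    | Landmark k i \<Rightarrow> landmark X k $ i)"

definition slam_obs :: "(real ^ 2 \<Rightarrow> real ^ 'q) \<Rightarrow> 'k::finite state \<Rightarrow> real ^ ('k \<times> 'q)" where
  "slam_obs h X = (\<chi> a. h (rel_pos X (fst a)) $ snd a)"

definition iekf_error :: "'k::finite state \<Rightarrow> 'k state \<Rightarrow> 'k state" where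
  "iekf_error X Y = (\<chi> c. case c of
      Heading \<Rightarrow> heading X - heading Y
    | Robot i \<Rightarrow>
        (robot X - robot Y - (heading X - heading Y) *\<^sub>R (quarter_turn *v robot Y)) $ i
    | Landmark k i \<Rightarrow>
        (landmark X k - landmark Y k
          - (heading X - heading Y) *\<^sub>R (quarter_turn *v landmark Y k)) $ i)"

lemma has_derivative_vec_components:
  fixes f :: "'a::real_normed_vector \<Rightarrow> real ^ 'n"
  assumes "\<And>i. ((\<lambda>x. f x $ i) has_derivative (\<lambda>d. f' d $ i)) (at x)"
  shows "(f has_derivative f') (at x)"
  using assms
  by (subst has_derivative_componentwise_within)
     (auto simp: Basis_vec_def inner_axis)

lemmas has_derivative_component =
  bounded_linear.has_derivative[OF bounded_linear_vec_nth]

lemma iekf_F_first_order: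
  fixes Y :: "'k::finite state"
  shows "((\<lambda>X. iekf_error (slam_step X om v 0 0) (slam_step Y om v 0 0)) has_derivative
      (\<lambda>D. iekf_F r n *v iekf_error (Y + D) Y)) (at Y)"
proof (rule has_derivative_vec_components)
  fix c :: "'k coord"
  show "((\<lambda>X. iekf_error (slam_step X om v 0 0) (slam_step Y om v 0 0) $ c) has_derivative
      (\<lambda>D. (iekf_F r n *v iekf_error (Y + D) Y) $ c)) (at Y)"
  proof (cases c)
    case Heading
    show ?thesis
      unfolding Heading iekf_F_def matrix_vector_mul_lid iekf_error_def slam_step_def heading_def
      by (simp, rule has_derivative_eq_rhs,
          (rule derivative_intros has_derivative_component)+, simp)
  next
    case (Robot i)
    show ?thesis
      unfolding Robot iekf_F_def matrix_vector_mul_lid iekf_error_def slam_step_def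
        heading_def robot_def rot_def quarter_turn_def
      by (rule disjE[OF exhaust_2[of i]];
          (simp add: matrix_vector_mult_def sum_2,
           rule has_derivative_eq_rhs,
           (rule derivative_intros has_derivative_component)+,
           simp add: fun_eq_iff algebra_simps))
  next
    case (Landmark k i)
    show ?thesis
      unfolding Landmark iekf_F_def matrix_vector_mul_lid iekf_error_def slam_step_def
        heading_def landmark_def quarter_turn_def
      by (rule disjE[OF exhaust_2[of i]];
          (simp add: matrix_vector_mult_def sum_2,
           rule has_derivative_eq_rhs,
           (rule derivative_intros has_derivative_component)+,
           simp add: fun_eq_iff algebra_simps))
  qed
qed

lemma obs_selector_mult: "obs_selector k *v X = landmark X k - robot X"
proof -
  have coord_sum: "(\<Sum>c\<in>UNIV. g c) =
      g Heading + ((\<Sum>j\<in>UNIV. g (Robot j)) + (\<Sum>l\<in>UNIV. \<Sum>j\<in>UNIV. g (Landmark l j)))"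
    for g :: "'a coord \<Rightarrow> real"
  proof -
    have inj: "inj (Robot :: 2 \<Rightarrow> 'a coord)" "inj (case_prod Landmark :: 'a \<times> 2 \<Rightarrow> 'a coord)"
      by (auto simp: inj_def)
    have "(\<Sum>c\<in>UNIV. g c) = g Heading + (sum g (range Robot) + sum g (range (case_prod Landmark)))"
      unfolding UNIV_coord
      by (subst sum.union_disjoint sum.union_disjoint[of "range Robot"]; auto)+
    then show ?thesis
      using inj
      by (simp add: sum.reindex sum.cartesian_product case_prod_unfold o_def)
  qed
  have 1: "(\<Sum>j\<in>UNIV. (if l = k then mat 1 else 0 :: real ^ 2 ^ 2) $ i $ j * X $ Landmark l j) =
      (if l = k then X $ Landmark k i else 0)" for l i
    using exhaust_2[of i] by (auto simp: sum_2 mat_def)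
  have "(obs_selector k *v X) $ i = (landmark X k - robot X) $ i" for i
    using exhaust_2[of i]
    by (auto simp: matrix_vector_mult_def obs_selector_def coord_sum 1 landmark_def robot_def)
       (auto simp: sum_2 mat_def)
  then show ?thesis by (simp add: vec_eq_iff)
qed

lemma rel_pos_has_derivative:
  fixes Y :: "'k::finite state"
  shows "((\<lambda>X. rel_pos X k) has_derivative
      (\<lambda>D. transpose (rot (heading Y)) *v (obs_selector k *v iekf_error (Y + D) Y))) (at Y)"
proof (rule has_derivative_vec_components)
  fix i :: 2
  show "((\<lambda>X. rel_pos X k $ i) has_derivative
      (\<lambda>D. (transpose (rot (heading Y)) *v (obs_selector k *v iekf_error (Y + D) Y)) $ i)) (at Y)"
    unfolding obs_selector_mult rel_pos_def iekf_error_def heading_def robot_def landmark_def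
      rot_def quarter_turn_def
    by (rule disjE[OF exhaust_2[of i]];
        (simp add: matrix_vector_mult_def transpose_def sum_2,
         rule has_derivative_eq_rhs,
         (rule derivative_intros has_derivative_component)+,
         simp add: fun_eq_iff algebra_simps))
qed

lemma iekf_H_first_order:
  fixes r :: "'k::finite run" and n :: nat and h :: "real ^ 2 \<Rightarrow> real ^ 'q"
  defines "Y \<equiv> predicted r n"
  assumes "\<And>k. h differentiable at (rel_pos Y k)"
  shows "(slam_obs h has_derivative (\<lambda>D. iekf_H h r n *v iekf_error (Y + D) Y)) (at Y)"
proof (rule has_derivative_vec_components)
  fix a :: "'k \<times> 'q"
  obtain k i where a: "a = (k, i)" by (cases a)
  have "(h has_derivative (\<lambda>x. jacobian h (at (rel_pos Y k)) *v x)) (at (rel_pos Y k))"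
    using assms(2)[of k] by (simp add: jacobian_works)
  from has_derivative_compose[OF rel_pos_has_derivative[of k Y] this]
  have "((\<lambda>X. h (rel_pos X k)) has_derivative
      (\<lambda>D. iekf_H_block h r n k *v iekf_error (Y + D) Y)) (at Y)"
    by (simp add: iekf_H_block_def Y_def matrix_vector_mul_assoc matrix_mul_assoc)
  from has_derivative_component[OF this, of i]
  show "((\<lambda>X. slam_obs h X $ a) has_derivative
      (\<lambda>D. (iekf_H h r n *v iekf_error (Y + D) Y) $ a)) (at Y)"
    by (simp add: a slam_obs_def iekf_H_def matrix_vector_mult_def)
qed

end

theory Submission
  imports Defs
begin

text \<open>
  A combination of the shifts moves the robot and all landmarks by the same vector, and each
  block row of the observation matrix factors through the differences of landmark and robot
  coordinates, whatever the linearization point. Since the propagation is trivial in the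
  invariant error, the shift stays in the common kernel of these rows.
\<close>

text \<open>The equation is linear in \<open>d\<close>, so checking the three generators suffices.
  The rotation passes because in the invariant error coordinates it has only a heading entry: its
  robot and landmark blocks are all zero.\<close>

lemma landmark_eq_robot_if_span_shifts:
  assumes "d \<in> span {rotation_shift, translation_shift (axis 1 1), translation_shift (axis 2 1)}"
  shows "landmark d k = robot d"
proof -
  have "subspace {d :: 'a state. landmark d k = robot d}"
    by (auto simp: subspace_def landmark_def robot_def vec_eq_iff)
  moreover have "{rotation_shift, translation_shift (axis 1 1), translation_shift (axis 2 1)}
      \<subseteq> {d :: 'a state. landmark d k = robot d}"
    by (auto simp: landmark_def robot_def rotation_shift_def translation_shift_def vec_eq_iff)
  ultimately show ?thesis
    using assms span_minimal by blast
qed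

lemma iekf_H_mult_eq_0:
  assumes "\<And>k. landmark d k = robot d"
  shows "iekf_H h r n *v d = 0"
proof -
  have "iekf_H_block h r n k *v d = 0" for k
    \<comment> \<open>Flipped associativity lets \<open>obs_selector k\<close> act on
      \<open>d\<close> first; by \<open>obs_selector_mult\<close> this gives
      \<open>landmark d k - robot d\<close>, which is zero.\<close>
    by (simp add: iekf_H_block_def obs_selector_mult assms flip: matrix_vector_mul_assoc)
  then show ?thesis
    by (simp add: iekf_H_def matrix_vector_mult_def vec_eq_iff)
qed

lemma shift_seq_iekf_F: "shift_seq (iekf_F r) d n = d"
  by (induction n) (simp_all add: iekf_F_def)

theorem theorem1:
  fixes h :: "real ^ 2 \<Rightarrow> real ^ 'q"
    and r :: "'k::finite run"
    and d :: "'k state"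
  assumes "CARD('q) \<in> {1, 2}"
    and "\<And>n k. h differentiable at (rel_pos (predicted r n) k)"
    and "d \<in> span {rotation_shift, translation_shift (axis 1 1), translation_shift (axis 2 1)}"
  shows "unobservable_shift (iekf_F r) (iekf_H h r) d"
  using landmark_eq_robot_if_span_shifts[OF assms(3)]
  by (simp add: unobservable_shift_def shift_seq_iekf_F iekf_H_mult_eq_0)

end
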